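(* Given an arbitrary token distribution $P\in\mathcal{P}$, $$\mathbb{D}(P,F_\beta)\le\mathbb{D}(P,F_{PR})-\beta\Big(1-\max_{t\in V}P(t)\Big).$$ Besides, if $\beta_1<\beta_2$, then $\mathbb{D}(P,F_{\beta_1})>\mathbb{D}(P,F_{\beta_2})$.
   Context: $V$ is a finite token set with $|V|=N$, and $\mathcal{P}$ is the set of probability distributions on $V$. $\mathbb{E}_k$ is expectation over a random watermark key $k$; over the random key, $\pi(\cdot\mid k):V\to\{1,\dots,N\}$ is a uniformly distributed random bijection (token permutation). For a map $F$ sending $(P,k)$ to a distribution $F(P,k)\in\mathcal{P}$, the expected total variation is $$\mathbb{D}(P,F):=1-\mathbb{E}_k\Big[\sum_{t\in V}\min\{P(t),F(P,k)(t)\}\Big].$$ The permute-reweight rule is $$F_{PR}(P,k)(t)=\max\Big\{2\!\!\sum_{t':\pi(t'|k)\le\pi(t|k)}\!\!P(t')-1,0\Big\}-\max\Big\{2\!\!\sum_{t':\pi(t'|k)\le\pi(t|k)-1}\!\!P(t')-1,0\Big\},$$ and the beta PDA-rule with parameter $\beta$ is $$F_\beta(P,k)(t)=(1-\beta)F_{PR}(P,k)(t)+\beta\Big[\max\Big\{2\!\!\sum_{t':\pi(t'|k)\ge\pi(t|k)}\!\!P(t')-1,0\Big\}-\max\Big\{2\!\!\sum_{t':\pi(t'|k)\ge\pi(t|k)+1}\!\!P(t')-1,0\Big\}\Big].$$ All parameters $\beta,\beta_1,\beta_2$ range from $0$ to $0.5$.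
   Formalization: The strict inequality D(P,F_{β1}) > D(P,F_{β2}) is stated only for P that is not a point mass; for a point mass F_β(P,k) = P, so D(P,F_β) = 0 for every β and the strict claim fails. *)

theory Defs
  imports "HOL-Probability.Probability"
begin

text \<open>The token set is a finite type \<open>'v\<close>, so \<open>N = CARD('v)\<close>, and a token distribution is a
  \<open>'v pmf\<close>. For a key \<open>k\<close>, the rank \<open>\<pi>(t | k)\<close> is written \<open>\<pi> k t\<close>.\<close>

definition token_perms :: "('v::finite \<Rightarrow> nat) set" where
  "token_perms = {\<sigma>. bij_betw \<sigma> UNIV {1..CARD('v)}}"

definition uniform_random_perm :: "'k measure \<Rightarrow> ('k \<Rightarrow> 'v::finite \<Rightarrow> nat) \<Rightarrow> bool" where
  "uniform_random_perm K \<pi> \<longleftrightarrow>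
     \<pi> \<in> K \<rightarrow>\<^sub>M count_space token_perms \<and>
     distr K (count_space token_perms) \<pi> = uniform_count_measure token_perms"

definition expected_tv ::
    "'k measure \<Rightarrow> 'v::finite pmf \<Rightarrow> ('v pmf \<Rightarrow> 'k \<Rightarrow> 'v \<Rightarrow> real) \<Rightarrow> real" where
  "expected_tv K P F = 1 - (\<integral>k. (\<Sum>t\<in>UNIV. min (pmf P t) (F P k t)) \<partial>K)"

text \<open>Ranks are at least 1, so the natural-number subtraction below does not truncate.
  Both rules are given by their values; \<open>F_PR_distribution\<close> and \<open>F_beta_distribution\<close> show
  that these values form probability distributions.\<close>

definition F_PR ::
    "('k \<Rightarrow> 'v::finite \<Rightarrow> nat) \<Rightarrow> 'v pmf \<Rightarrow> 'k \<Rightarrow> 'v \<Rightarrow> real" where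
  "F_PR \<pi> P k t =
     max (2 * (\<Sum>t' | \<pi> k t' \<le> \<pi> k t. pmf P t') - 1) 0
     - max (2 * (\<Sum>t' | \<pi> k t' \<le> \<pi> k t - 1. pmf P t') - 1) 0"

definition F_beta ::
    "('k \<Rightarrow> 'v::finite \<Rightarrow> nat) \<Rightarrow> real \<Rightarrow> 'v pmf \<Rightarrow> 'k \<Rightarrow> 'v \<Rightarrow> real" where
  "F_beta \<pi> \<beta> P k t =
     (1 - \<beta>) * F_PR \<pi> P k t
     + \<beta> * (max (2 * (\<Sum>t' | \<pi> k t' \<ge> \<pi> k t. pmf P t') - 1) 0
            - max (2 * (\<Sum>t' | \<pi> k t' \<ge> \<pi> k t + 1. pmf P t') - 1) 0)"

lemma F_PR_distribution:
  fixes P :: "'v::finite pmf"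
  assumes "\<pi> k \<in> token_perms"
  shows F_PR_nonneg: "F_PR \<pi> P k t \<ge> 0"
    and F_PR_sum: "(\<Sum>t\<in>UNIV. F_PR \<pi> P k t) = 1"
proof -
  have bij: "bij_betw (\<pi> k) UNIV {1..CARD('v)}"
    using assms by (simp add: token_perms_def)
  have "(\<Sum>t' | \<pi> k t' \<le> \<pi> k t - 1. pmf P t') \<le> (\<Sum>t' | \<pi> k t' \<le> \<pi> k t. pmf P t')"
    by (intro sum_mono2) auto
  then show "F_PR \<pi> P k t \<ge> 0"
    unfolding F_PR_def by linarith
  define g where "g i = max (2 * (\<Sum>t' | \<pi> k t' \<le> i. pmf P t') - 1) 0" for i
  have "(\<Sum>t\<in>UNIV. F_PR \<pi> P k t) = (\<Sum>t\<in>UNIV. g (\<pi> k t) - g (\<pi> k t - 1))"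
    by (simp add: F_PR_def g_def)
  also have "\<dots> = (\<Sum>i = 1..CARD('v). g i - g (i - 1))"
    by (rule sum.reindex_bij_betw[OF bij])
  also have "\<dots> = g CARD('v) - g 0"
    using sum_telescope''[of 0 "CARD('v)" g]
    by (simp add: atLeastSucAtMost_greaterThanAtMost[symmetric])
  also have "\<dots> = 1"
  proof -
    have "\<pi> k t' \<in> {1..CARD('v)}" for t'
      using bij by (auto simp: bij_betw_def)
    then have "\<pi> k t' \<le> CARD('v)" "\<not> \<pi> k t' \<le> 0" for t'
      by (simp_all add: Suc_le_eq)
    then show ?thesis
      by (simp add: g_def sum_pmf_eq_1 del: le_zero_eq)
  qed
  finally show "(\<Sum>t\<in>UNIV. F_PR \<pi> P k t) = 1" .
qed

lemma F_beta_distribution: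
  fixes P :: "'v::finite pmf"
  assumes "\<pi> k \<in> token_perms" and "0 \<le> \<beta>" and "\<beta> \<le> 1"
  shows F_beta_nonneg: "F_beta \<pi> \<beta> P k t \<ge> 0"
    and F_beta_sum: "(\<Sum>t\<in>UNIV. F_beta \<pi> \<beta> P k t) = 1"
proof -
  have bij: "bij_betw (\<pi> k) UNIV {1..CARD('v)}"
    using assms by (simp add: token_perms_def)
  have "(\<Sum>t' | \<pi> k t' \<ge> \<pi> k t + 1. pmf P t') \<le> (\<Sum>t' | \<pi> k t' \<ge> \<pi> k t. pmf P t')"
    by (intro sum_mono2) auto
  then have "max (2 * (\<Sum>t' | \<pi> k t' \<ge> \<pi> k t. pmf P t') - 1) 0
      - max (2 * (\<Sum>t' | \<pi> k t' \<ge> \<pi> k t + 1. pmf P t') - 1) 0 \<ge> 0"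
    by linarith
  then show "F_beta \<pi> \<beta> P k t \<ge> 0"
    unfolding F_beta_def using F_PR_nonneg[of \<pi> k P t] assms
    by (intro add_nonneg_nonneg mult_nonneg_nonneg) auto
  define h where "h i = max (2 * (\<Sum>t' | \<pi> k t' \<ge> i. pmf P t') - 1) 0" for i
  have "(\<Sum>t\<in>UNIV. h (\<pi> k t) - h (\<pi> k t + 1)) = (\<Sum>i = 1..CARD('v). h i - h (i + 1))"
    by (rule sum.reindex_bij_betw[OF bij])
  also have "\<dots> = h 1 - h (CARD('v) + 1)"
    using sum_Suc_diff[of 1 "CARD('v)" "\<lambda>i. - h i"] by simp
  also have "\<dots> = 1"
  proof -
    have "\<pi> k t' \<in> {1..CARD('v)}" for t'
      using bij by (auto simp: bij_betw_def)
    then have "1 \<le> \<pi> k t'" "\<not> CARD('v) + 1 \<le> \<pi> k t'" for t'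
      by (simp_all add: Suc_le_eq not_less)
    then show ?thesis
      unfolding h_def by (simp add: sum_pmf_eq_1 del: One_nat_def Suc_le_eq add_Suc_right add_Suc)
  qed
  finally have "(\<Sum>t\<in>UNIV. h (\<pi> k t) - h (\<pi> k t + 1)) = 1" .
  moreover have "(\<Sum>t\<in>UNIV. F_beta \<pi> \<beta> P k t)
      = (1 - \<beta>) * (\<Sum>t\<in>UNIV. F_PR \<pi> P k t) + \<beta> * (\<Sum>t\<in>UNIV. h (\<pi> k t) - h (\<pi> k t + 1))"
    by (simp add: F_beta_def h_def sum.distrib sum_distrib_left)
  ultimately show "(\<Sum>t\<in>UNIV. F_beta \<pi> \<beta> P k t) = 1"
    using F_PR_sum[of \<pi> k P] assms by simp
qed

end

theory Submission imports Defs begin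

text \<open>The beta rule interpolates between the permute-reweight rule and \<open>P\<close> itself.
  Lay the tokens out on \<open>[0, 1]\<close> in the order of their ranks, token \<open>t\<close> occupying an interval of
  length \<open>P t\<close>. The two halves of the beta rule assign to \<open>t\<close> twice the length of the part of its
  interval to the right, respectively to the left, of \<open>1/2\<close>; together these make \<open>2 * P t\<close>, so
  \<open>F\<^sub>\<beta> = (1 - 2 * \<beta>) * F\<^sub>P\<^sub>R + 2 * \<beta> * P\<close> and the expected total variation scales by
  \<open>1 - 2 * \<beta>\<close>. Moreover every token whose interval does not contain \<open>1/2\<close> in its interior
  contributes its full mass to \<open>\<Sum>t. \<bar>F\<^sub>P\<^sub>R t - P t\<bar>\<close>, and at most one token is exceptional, so the
  total variation between \<open>P\<close> and \<open>F\<^sub>P\<^sub>R\<close> is at least \<open>(1 - max P) / 2\<close> for each single key.\<close>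

lemma token_perms_pos:
  assumes "\<sigma> \<in> token_perms"
  shows "1 \<le> \<sigma> t"
  using assms by (auto simp: token_perms_def bij_betw_def)

lemma sum_pmf_rank_ge:
  fixes P :: "'v::finite pmf" and r :: "'v \<Rightarrow> nat"
  assumes "1 \<le> i"
  shows "(\<Sum>t' | i \<le> r t'. pmf P t') = 1 - (\<Sum>t' | r t' \<le> i - 1. pmf P t')"
proof -
  have "{t'. i \<le> r t'} = UNIV - {t'. r t' \<le> i - 1}"
    using assms by auto
  then show ?thesis
    by (simp add: sum_diff sum_pmf_eq_1)
qed

lemma sum_pmf_rank_le:
  fixes P :: "'v::finite pmf"
  assumes "\<sigma> \<in> token_perms"
  shows "(\<Sum>t' | \<sigma> t' \<le> \<sigma> t. pmf P t') = (\<Sum>t' | \<sigma> t' \<le> \<sigma> t - 1. pmf P t') + pmf P t"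
proof -
  have inj: "inj \<sigma>"
    using assms by (simp add: token_perms_def bij_betw_def)
  \<comment> \<open>Injectivity leaves \<open>t\<close> as the only token of its rank, and ranks
    being at least 1 keeps the subtraction on naturals from truncating.\<close>
  have "{t'. \<sigma> t' \<le> \<sigma> t} = insert t {t'. \<sigma> t' \<le> \<sigma> t - 1}"
    using token_perms_pos[OF assms, of t] injD[OF inj]
    by (auto simp: le_less dest: less_imp_le)
  moreover have "t \<notin> {t'. \<sigma> t' \<le> \<sigma> t - 1}"
    using token_perms_pos[OF assms, of t] by simp
  ultimately show ?thesis
    by simp
qed

lemma F_beta_eq_F_PR:
  fixes P :: "'v::finite pmf"
  assumes "\<pi> k \<in> token_perms"
  shows "F_beta \<pi> \<beta> P k t = (1 - 2 * \<beta>) * F_PR \<pi> P k t + 2 * \<beta> * pmf P t"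
proof -
  define a where "a = (\<Sum>t' | \<pi> k t' \<le> \<pi> k t - 1. pmf P t')"
  have le: "(\<Sum>t' | \<pi> k t' \<le> \<pi> k t. pmf P t') = a + pmf P t"
    unfolding a_def by (rule sum_pmf_rank_le[OF assms])
  have ge: "(\<Sum>t' | \<pi> k t \<le> \<pi> k t'. pmf P t') = 1 - a"
    unfolding a_def by (rule sum_pmf_rank_ge[OF token_perms_pos[OF assms]])
  have gt: "(\<Sum>t' | \<pi> k t + 1 \<le> \<pi> k t'. pmf P t') = 1 - (a + pmf P t)"
    using sum_pmf_rank_ge[where i = "\<pi> k t + 1" and r = "\<pi> k" and P = P] le by simp
  have PR: "F_PR \<pi> P k t = max (2 * (a + pmf P t) - 1) 0 - max (2 * a - 1) 0"
    unfolding F_PR_def le a_def ..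
  \<comment> \<open>With \<open>a\<close> the left end of the interval of \<open>t\<close>, this is
    \<open>max (- x) 0 = max x 0 - x\<close>, applied at \<open>x = 2 * a - 1\<close> and at
    \<open>x = 2 * (a + pmf P t) - 1\<close>.\<close>
  have rev: "max (2 * (1 - a) - 1) 0 - max (2 * (1 - (a + pmf P t)) - 1) 0
      = 2 * pmf P t - F_PR \<pi> P k t"
    unfolding PR by (simp add: max_def)
  show ?thesis
    unfolding F_beta_def ge gt rev by (simp add: algebra_simps)
qed

text \<open>Both arguments of the minimum share the summand \<open>2 * \<beta> * pmf P t\<close>,
  and the factor \<open>1 - 2 * \<beta>\<close> can be pulled out because it is nonnegative.\<close>

lemma overlap_F_beta:
  fixes P :: "'v::finite pmf"
  assumes "\<pi> k \<in> token_perms" and "\<beta> \<le> 1/2"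
  shows "(\<Sum>t\<in>UNIV. min (pmf P t) (F_beta \<pi> \<beta> P k t))
    = 2 * \<beta> + (1 - 2 * \<beta>) * (\<Sum>t\<in>UNIV. min (pmf P t) (F_PR \<pi> P k t))"
proof -
  have "min (pmf P t) (F_beta \<pi> \<beta> P k t)
      = 2 * \<beta> * pmf P t + (1 - 2 * \<beta>) * min (pmf P t) (F_PR \<pi> P k t)" for t
  proof -
    have "min (pmf P t) (F_beta \<pi> \<beta> P k t)
        = min (2 * \<beta> * pmf P t + (1 - 2 * \<beta>) * pmf P t)
            (2 * \<beta> * pmf P t + (1 - 2 * \<beta>) * F_PR \<pi> P k t)"
      by (simp add: F_beta_eq_F_PR[of \<pi> k, OF assms(1)] algebra_simps)
    then show ?thesis
      using assms(2) by (simp only: min_add_distrib_right[symmetric] min_mult_distrib_left) simp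
  qed
  then show ?thesis
    by (simp add: sum.distrib sum_pmf_eq_1 flip: sum_distrib_left)
qed

lemma overlap_F_PR_le:
  fixes P :: "'v::finite pmf"
  assumes perm: "\<pi> k \<in> token_perms"
  shows "(\<Sum>t\<in>UNIV. min (pmf P t) (F_PR \<pi> P k t)) \<le> (1 + (MAX t. pmf P t)) / 2"
proof -
  define a where "a t = (\<Sum>t' | \<pi> k t' \<le> \<pi> k t - 1. pmf P t')" for t
  have le: "(\<Sum>t' | \<pi> k t' \<le> \<pi> k t. pmf P t') = a t + pmf P t" for t
    unfolding a_def by (rule sum_pmf_rank_le[OF perm])
  have PR: "F_PR \<pi> P k t = max (2 * (a t + pmf P t) - 1) 0 - max (2 * a t - 1) 0" for t
    unfolding F_PR_def le a_def ..
  define S where "S = {t. a t < 1/2 \<and> 1/2 < a t + pmf P t}"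
  have disj: "a t + pmf P t \<le> a s" if "\<pi> k t < \<pi> k s" for s t
    unfolding le[symmetric] unfolding a_def by (rule sum_mono2) (use that in auto)
  have inj: "inj (\<pi> k)"
    using perm by (simp add: token_perms_def bij_betw_def)
  \<comment> \<open>Of two distinct tokens the one ranked first ends no later than the other begins,
    so 1/2 cannot lie strictly inside both intervals.\<close>
  have uniq: "t = s" if "t \<in> S" "s \<in> S" for s t
    using disj[of s t] disj[of t s] that injD[OF inj, of s t]
    by (force simp: S_def linorder_neq_iff)
  have "sum (pmf P) S \<le> (MAX t. pmf P t)"
  proof (cases "S = {}")
    case True
    \<comment> \<open>\<open>undefined\<close> serves as an arbitrary token: any one shows that the
      maximum is nonnegative.\<close>
    have "0 \<le> pmf P undefined"
      by simp
    also have "\<dots> \<le> (MAX t. pmf P t)"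
      by (rule Max_ge) auto
    finally show ?thesis
      using True by simp
  next
    case False
    then obtain s where "S = {s}"
      using uniq by blast
    then show ?thesis
      by (simp add: Max_ge)
  qed
  moreover have "sum (pmf P) (UNIV - S) \<le> (\<Sum>t\<in>UNIV. \<bar>F_PR \<pi> P k t - pmf P t\<bar>)"
  proof -
    have "pmf P t \<le> \<bar>F_PR \<pi> P k t - pmf P t\<bar>" if "t \<notin> S" for t
    proof -
      \<comment> \<open>Either \<open>x + p \<le> 1/2\<close> and the rule assigns 0, or
        \<open>1/2 \<le> x\<close> and it assigns \<open>2 * p\<close>; both values are at distance
        \<open>p\<close> from \<open>p\<close>.\<close>
      have "p \<le> \<bar>max (2 * (x + p) - 1) 0 - max (2 * x - 1) 0 - p\<bar>"
        if "0 \<le> p" "\<not> (x < 1/2 \<and> 1/2 < x + p)" for x p :: real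
        using that by (auto simp: max_def abs_if)
      then show ?thesis
        unfolding PR using that by (simp add: S_def)
    qed
    then have "sum (pmf P) (UNIV - S) \<le> (\<Sum>t\<in>UNIV - S. \<bar>F_PR \<pi> P k t - pmf P t\<bar>)"
      by (intro sum_mono) auto
    also have "\<dots> \<le> (\<Sum>t\<in>UNIV. \<bar>F_PR \<pi> P k t - pmf P t\<bar>)"
      by (intro sum_mono2) auto
    finally show ?thesis .
  qed
  ultimately have dist: "1 - (MAX t. pmf P t) \<le> (\<Sum>t\<in>UNIV. \<bar>F_PR \<pi> P k t - pmf P t\<bar>)"
    by (simp add: sum_diff sum_pmf_eq_1)
  have half: "min (pmf P t) (F_PR \<pi> P k t)
      = (pmf P t + F_PR \<pi> P k t - \<bar>F_PR \<pi> P k t - pmf P t\<bar>) / 2" for t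
    by (simp add: min_def)
  have "(\<Sum>t\<in>UNIV. min (pmf P t) (F_PR \<pi> P k t))
      = (\<Sum>t\<in>UNIV. (pmf P t + F_PR \<pi> P k t - \<bar>F_PR \<pi> P k t - pmf P t\<bar>) / 2)"
    by (simp only: half)
  also have "\<dots> = (2 - (\<Sum>t\<in>UNIV. \<bar>F_PR \<pi> P k t - pmf P t\<bar>)) / 2"
    by (simp add: sum.distrib sum_subtractf sum_pmf_eq_1 F_PR_sum[of \<pi> k P, OF perm]
        sum_divide_distrib[symmetric])
  finally show ?thesis
    using dist by simp
qed

text \<open>The overlap depends on the key only through its permutation. Permutations carry the
  discrete sigma-algebra, so measurability is automatic, and the overlap lies between 0 and
  1.\<close>

lemma integrable_overlap_F_PR:
  fixes P :: "'v::finite pmf"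
  assumes "prob_space K" and "\<pi> \<in> K \<rightarrow>\<^sub>M count_space token_perms"
  shows "integrable K (\<lambda>k. \<Sum>t\<in>UNIV. min (pmf P t) (F_PR \<pi> P k t))"
proof -
  interpret prob_space K by fact
  \<comment> \<open>Taking \<open>id\<close> for the rank map lets the permutation act as its own
    key.\<close>
  define m where "m \<sigma> = (\<Sum>t\<in>UNIV. min (pmf P t) (F_PR id P \<sigma> t))" for \<sigma>
  have eq: "(\<lambda>k. \<Sum>t\<in>UNIV. min (pmf P t) (F_PR \<pi> P k t)) = (\<lambda>k. m (\<pi> k))"
    by (simp add: m_def F_PR_def)
  show ?thesis
    unfolding eq
  proof (rule integrable_const_bound[where B = 1])
    show "AE k in K. norm (m (\<pi> k)) \<le> 1"
    proof (rule AE_I2)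
      fix k
      assume "k \<in> space K"
      then have "id (\<pi> k) \<in> token_perms"
        using measurable_space[OF assms(2)] by simp
      then have "0 \<le> m (\<pi> k)"
        unfolding m_def by (intro sum_nonneg min.boundedI pmf_nonneg F_PR_nonneg)
      moreover have "m (\<pi> k) \<le> sum (pmf P) UNIV"
        unfolding m_def by (intro sum_mono) simp
      ultimately show "norm (m (\<pi> k)) \<le> 1"
        by (simp add: sum_pmf_eq_1)
    qed
    show "(\<lambda>k. m (\<pi> k)) \<in> borel_measurable K"
      by (rule measurable_compose[OF assms(2)]) simp
  qed
qed

lemma expected_tv_F_beta:
  fixes P :: "'v::finite pmf"
  assumes "prob_space K" and meas: "\<pi> \<in> K \<rightarrow>\<^sub>M count_space token_perms" and "\<beta> \<le> 1/2"
  shows "expected_tv K P (F_beta \<pi> \<beta>) = (1 - 2 * \<beta>) * expected_tv K P (F_PR \<pi>)"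
proof -
  interpret prob_space K by fact
  have "(\<integral>k. (\<Sum>t\<in>UNIV. min (pmf P t) (F_beta \<pi> \<beta> P k t)) \<partial>K)
      = (\<integral>k. 2 * \<beta> + (1 - 2 * \<beta>) * (\<Sum>t\<in>UNIV. min (pmf P t) (F_PR \<pi> P k t)) \<partial>K)"
    using measurable_space[OF meas] assms(3)
    by (intro Bochner_Integration.integral_cong refl overlap_F_beta) auto
  also have "\<dots> = 2 * \<beta> + (1 - 2 * \<beta>) * (\<integral>k. (\<Sum>t\<in>UNIV. min (pmf P t) (F_PR \<pi> P k t)) \<partial>K)"
    by (subst Bochner_Integration.integral_add)
      (simp_all only: integrable_const integrable_mult_right integrable_overlap_F_PR[OF assms(1,2)]
        integral_mult_right_zero lebesgue_integral_const prob_space scaleR_one)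
  finally show ?thesis
    by (simp add: expected_tv_def algebra_simps)
qed

text \<open>The bound on the overlap holds key by key, so it survives averaging.\<close>

lemma expected_tv_F_PR_ge:
  fixes P :: "'v::finite pmf"
  assumes "prob_space K" and meas: "\<pi> \<in> K \<rightarrow>\<^sub>M count_space token_perms"
  shows "(1 - (MAX t. pmf P t)) / 2 \<le> expected_tv K P (F_PR \<pi>)"
proof -
  interpret prob_space K by fact
  have "(\<integral>k. (\<Sum>t\<in>UNIV. min (pmf P t) (F_PR \<pi> P k t)) \<partial>K) \<le> (1 + (MAX t. pmf P t)) / 2"
    by (intro integral_le_const integrable_overlap_F_PR assms AE_I2 overlap_F_PR_le)
      (use measurable_space[OF meas] in simp)
  then show ?thesis
    unfolding expected_tv_def by (simp add: field_simps)
qed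

text \<open>A token of mass 1 would carry the whole support, making \<open>P\<close> a point mass;
  since there are finitely many tokens, the maximum is attained and hence stays below 1.\<close>

lemma Max_pmf_less_1:
  fixes P :: "'v::finite pmf"
  assumes "\<And>t. P \<noteq> return_pmf t"
  shows "(MAX t. pmf P t) < 1"
proof -
  have "pmf P t < 1" for t
  proof (rule ccontr)
    assume "\<not> pmf P t < 1"
    then have "pmf P t = 1"
      using pmf_le_1[of P t] by simp
    then have "measure (measure_pmf P) {t} = 1"
      by (simp add: measure_pmf_single)
    then have "set_pmf P \<subseteq> {t}"
      by (auto simp: measure_pmf.prob_eq_1 AE_measure_pmf_iff)
    then show False
      using assms[of t] by (simp add: set_pmf_subset_singleton)
  qed
  then show ?thesis
    by simp
qed

theorem theorem5p4:
  fixes K :: "'k measure" and \<pi> :: "'k \<Rightarrow> 'v::finite \<Rightarrow> nat" and P :: "'v pmf"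
  assumes "prob_space K" and "uniform_random_perm K \<pi>"
  shows "(\<forall>\<beta>\<in>{0..1/2}.
            expected_tv K P (F_beta \<pi> \<beta>)
              \<le> expected_tv K P (F_PR \<pi>) - \<beta> * (1 - (MAX t. pmf P t)))
       \<and> ((\<forall>t. P \<noteq> return_pmf t) \<longrightarrow>
            (\<forall>\<beta>\<^sub>1\<in>{0..1/2}. \<forall>\<beta>\<^sub>2\<in>{0..1/2}. \<beta>\<^sub>1 < \<beta>\<^sub>2 \<longrightarrow>
               expected_tv K P (F_beta \<pi> \<beta>\<^sub>1) > expected_tv K P (F_beta \<pi> \<beta>\<^sub>2)))"
proof -
  have meas: "\<pi> \<in> K \<rightarrow>\<^sub>M count_space token_perms"
    using assms(2) by (simp add: uniform_random_perm_def)
  define D where "D = expected_tv K P (F_PR \<pi>)"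
  have scale: "expected_tv K P (F_beta \<pi> \<beta>) = (1 - 2 * \<beta>) * D" if "\<beta> \<in> {0..1/2}" for \<beta>
    unfolding D_def using that by (intro expected_tv_F_beta[OF assms(1) meas]) simp
  have lower: "(1 - (MAX t. pmf P t)) / 2 \<le> D"
    unfolding D_def by (rule expected_tv_F_PR_ge[OF assms(1) meas])
  show ?thesis
    unfolding D_def[symmetric]
  proof (intro conjI ballI impI)
    fix \<beta> :: real
    assume \<beta>: "\<beta> \<in> {0..1/2}"
    \<comment> \<open>By scaling, passing from \<open>F_PR\<close> to \<open>F_beta\<close> lowers
      the total variation by exactly \<open>2 * \<beta> * D\<close>.\<close>
    have "\<beta> * (1 - (MAX t. pmf P t)) \<le> \<beta> * (2 * D)"
      using \<beta> lower by (intro mult_left_mono) auto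
    then show "expected_tv K P (F_beta \<pi> \<beta>) \<le> D - \<beta> * (1 - (MAX t. pmf P t))"
      by (simp add: scale[OF \<beta>] algebra_simps)
  next
    fix \<beta>\<^sub>1 \<beta>\<^sub>2 :: real
    assume nondeg: "\<forall>t. P \<noteq> return_pmf t" and \<beta>: "\<beta>\<^sub>1 \<in> {0..1/2}" "\<beta>\<^sub>2 \<in> {0..1/2}" "\<beta>\<^sub>1 < \<beta>\<^sub>2"
    \<comment> \<open>Strictness needs \<open>D > 0\<close>. For a point mass the permute-reweight
      rule returns \<open>P\<close> itself, so \<open>D = 0\<close> and all values of \<beta>
      tie.\<close>
    have "(MAX t. pmf P t) < 1"
      using nondeg by (intro Max_pmf_less_1) auto
    then have "0 < (1 - (MAX t. pmf P t)) / 2"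
      by simp
    then have "0 < D"
      using lower by (rule less_le_trans)
    then show "expected_tv K P (F_beta \<pi> \<beta>\<^sub>1) > expected_tv K P (F_beta \<pi> \<beta>\<^sub>2)"
      using \<beta> by (simp add: scale)
  qed
qed

end
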